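(* Let $l<h$ be such that $h/l$ is constant, let $f(n)\in o(n)$, where $n$ is the number of agents, and suppose that the private valuations take on only the two values $l$ and $h$. There does not exist a polynomial-time, monotone, approximation-ratio-preserving transformation $\mathcal{T}$ (for downward-closed single-parameter environments) under the following rules: $\mathcal{T}$ is allowed to be randomized and adaptive, but it cannot make queries to the feasibility set $\mathcal{F}$ and can only make queries to the algorithm $\mathcal{A}$ on inputs that are of Hamming distance less than $f(n)$ from the original input.
   Context: A single-parameter environment consists of $n$ agents, where agent $i$ has a private valuation $v_i\in\mathbb{R}$ (its value per unit of stuff that it gets; here $v_i\in\{l,h\}$), and a feasibility set $\mathcal{F}$ whose elements, the feasible allocations, are vectors $\mathbf{x}=(x_i)_{i=1}^n$ with $x_i\in\mathbb{R}$ denoting the amount of stuff given to agent $i$. The environment is downward-closed if, whenever we take an allocation in $\mathcal{F}$ and decrease the amount of stuff given to one of the agents, the resulting allocation is also in $\mathcal{F}$. Constant means not depending on $n$. An algorithm (or allocation rule) $\mathcal{A}$ is a function that takes a valuation vector $\mathbf{v}=(v_i)_{i=1}^n$ (the input) and outputs an allocation $\mathbf{x}\in\mathcal{F}$. The welfare of $\mathcal{A}$ at $\mathbf{v}$, also written $\mathcal{A}(\mathbf{v})$, is $\mathbf{v}\cdot\mathbf{x}=v_1x_1+\dots+v_nx_n$. $OPT_{\mathcal{F}}(\mathbf{v})$ is the maximum welfare at $\mathbf{v}$ over all allocations in $\mathcal{F}$, and the (worst-case) approximation ratio of $\mathcal{A}$ is $approx_{\mathcal{F}}(\mathcal{A})=\min_{\mathbf{v}}\frac{\mathcal{A}(\mathbf{v})}{OPT_{\mathcal{F}}(\mathbf{v})}$.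 An allocation rule is monotone if, whenever an agent increases its declared valuation while the declared valuations of the remaining agents stay fixed, the agent is allocated at least as much stuff as before. A transformation $\mathcal{T}$ is an algorithm that has black-box access to some other algorithm $\mathcal{A}$: in each query it specifies a valuation vector and obtains the allocation that $\mathcal{A}$ returns there. $\mathcal{T}(\mathcal{A})$ denotes $\mathcal{T}$ with access to $\mathcal{A}$; the original input is the valuation vector at which $\mathcal{T}(\mathcal{A})$ is being evaluated. $\mathcal{T}$ has the knowledge that $\mathcal{F}$ is downward-closed. A query to $\mathcal{F}$ would ask whether a particular allocation belongs to $\mathcal{F}$. $\mathcal{T}$ is adaptive if it can adjust its next query based on the responses it received for previous queries. Polynomial means polynomial in $n$. $\mathcal{T}$ is monotone if $\mathcal{T}(\mathcal{A})$ is a monotone allocation rule for any algorithm $\mathcal{A}$. $\mathcal{T}$ is approximation-ratio-preserving if, for any algorithm $\mathcal{A}$, $\mathcal{T}(\mathcal{A})$ preserves the approximation ratio of $\mathcal{A}$, i.e. $approx_{\mathcal{F}}(\mathcal{T}(\mathcal{A}))\ge approx_{\mathcal{F}}(\mathcal{A})$. *)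

theory Defs
  imports
    "HOL-Probability.Probability_Mass_Function"
    "HOL-Computational_Algebra.Polynomial"
    "HOL-Library.Landau_Symbols"
begin

text \<open>
  The number of agents varies within the statement, so vectors in \<open>n\<close>-dimensional space are
  lists of length \<open>n\<close>; agents are the indices \<open>i < n\<close>.
\<close>

type_synonym valuation = "real list"
type_synonym allocation = "real list"
type_synonym algorithm = "valuation \<Rightarrow> allocation"

definition valuations :: "nat \<Rightarrow> real \<Rightarrow> real \<Rightarrow> valuation set" where
  "valuations n l h = {v. length v = n \<and> set v \<subseteq> {l, h}}"

definition welfare :: "valuation \<Rightarrow> allocation \<Rightarrow> real" where
  "welfare v x = (\<Sum>i<length v. v ! i * x ! i)"

definition downward_closed :: "allocation set \<Rightarrow> bool" where
  "downward_closed F \<longleftrightarrow> (\<forall>x\<in>F. \<forall>i<length x. \<forall>a\<le>x ! i. x[i := a] \<in> F)"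

text \<open>
  The last conjunct makes the approximation ratio meaningful: at every valuation vector the
  maximum welfare exists and is positive, so that one may divide by it.
\<close>

definition environment :: "nat \<Rightarrow> real \<Rightarrow> real \<Rightarrow> allocation set \<Rightarrow> bool" where
  "environment n l h F \<longleftrightarrow>
     (\<forall>x\<in>F. length x = n) \<and> downward_closed F \<and>
     (\<forall>v\<in>valuations n l h.
        \<exists>x\<in>F. (\<forall>y\<in>F. welfare v y \<le> welfare v x) \<and> 0 < welfare v x)"

definition algorithm_for :: "nat \<Rightarrow> real \<Rightarrow> real \<Rightarrow> allocation set \<Rightarrow> algorithm \<Rightarrow> bool" where
  "algorithm_for n l h F A \<longleftrightarrow> (\<forall>v\<in>valuations n l h. A v \<in> F)"

text \<open>In an \<open>environment\<close> the supremum is attained.\<close>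

definition OPT :: "allocation set \<Rightarrow> valuation \<Rightarrow> real" where
  "OPT F v = (SUP x\<in>F. welfare v x)"

text \<open>
  \<open>W v\<close> is the (expected) welfare achieved at \<open>v\<close>. The minimum ranges over a finite set.
\<close>

definition approx_ratio ::
    "nat \<Rightarrow> real \<Rightarrow> real \<Rightarrow> allocation set \<Rightarrow> (valuation \<Rightarrow> real) \<Rightarrow> real" where
  "approx_ratio n l h F W = Min ((\<lambda>v. W v / OPT F v) ` valuations n l h)"

definition hamming :: "'a list \<Rightarrow> 'a list \<Rightarrow> nat" where
  "hamming v w = card {i. i < length v \<and> v ! i \<noteq> w ! i}"

text \<open>
  A randomized adaptive computation with access to an oracle: it outputs an allocation, performs
  an elementary step of its own, tosses a coin showing \<open>True\<close> with probability \<open>p\<close>, or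
  submits a query and continues depending on the answer. There is no access to the feasibility
  set. Unfolding the execution of any concrete kind of machine, with one node per elementary
  operation, gives such a tree, whose path lengths are the running times; the trees themselves
  need not be uniform in the number of agents.
\<close>

datatype computation =
    Output allocation
  | Compute computation
  | Toss real "bool \<Rightarrow> computation"
  | Query valuation "allocation \<Rightarrow> computation"

text \<open>The distribution of the set of queries made, the number of steps, and the output.\<close>

primrec run :: "computation \<Rightarrow> algorithm \<Rightarrow> (valuation set \<times> nat \<times> allocation) pmf" where
  "run (Output x) A = return_pmf ({}, 1, x)"
| "run (Compute c) A = map_pmf (\<lambda>(Q, t, x). (Q, Suc t, x)) (run c A)"
| "run (Toss p k) A =
     bind_pmf (bernoulli_pmf p) (\<lambda>b. map_pmf (\<lambda>(Q, t, x). (Q, Suc t, x)) (run (k b) A))"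
| "run (Query w k) A = map_pmf (\<lambda>(Q, t, x). (insert w Q, Suc t, x)) (run (k (A w)) A)"

text \<open>
  A transformation maps the original input (whose length is the number of agents) to the
  computation carried out on it.
\<close>

type_synonym transformation = "valuation \<Rightarrow> computation"

definition result :: "transformation \<Rightarrow> algorithm \<Rightarrow> valuation \<Rightarrow> allocation pmf" where
  "result T A v = map_pmf (\<lambda>(Q, t, x). x) (run (T v) A)"

definition exp_alloc :: "transformation \<Rightarrow> algorithm \<Rightarrow> valuation \<Rightarrow> nat \<Rightarrow> real" where
  "exp_alloc T A v i = measure_pmf.expectation (result T A v) (\<lambda>x. x ! i)"

definition exp_welfare :: "transformation \<Rightarrow> algorithm \<Rightarrow> valuation \<Rightarrow> real" where
  "exp_welfare T A v = measure_pmf.expectation (result T A v) (welfare v)"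

text \<open>
  In the following, \<open>l n\<close> and \<open>h n\<close> are the two possible values in environments with \<open>n\<close> agents.
  A transformation has to yield an allocation rule for the unknown feasibility set: whatever the
  coin tosses, the output is feasible.
\<close>

definition valid_transformation ::
    "(nat \<Rightarrow> real) \<Rightarrow> (nat \<Rightarrow> real) \<Rightarrow> transformation \<Rightarrow> bool" where
  "valid_transformation l h T \<longleftrightarrow>
     (\<forall>n F A. environment n (l n) (h n) F \<longrightarrow> algorithm_for n (l n) (h n) F A \<longrightarrow>
        (\<forall>v\<in>valuations n (l n) (h n). set_pmf (result T A v) \<subseteq> F))"

definition monotone_transformation ::
    "(nat \<Rightarrow> real) \<Rightarrow> (nat \<Rightarrow> real) \<Rightarrow> transformation \<Rightarrow> bool" where
  "monotone_transformation l h T \<longleftrightarrow>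
     (\<forall>n F A. environment n (l n) (h n) F \<longrightarrow> algorithm_for n (l n) (h n) F A \<longrightarrow>
        (\<forall>v\<in>valuations n (l n) (h n). \<forall>i<n. \<forall>a\<in>{l n, h n}.
           v ! i \<le> a \<longrightarrow> exp_alloc T A v i \<le> exp_alloc T A (v[i := a]) i))"

definition ratio_preserving ::
    "(nat \<Rightarrow> real) \<Rightarrow> (nat \<Rightarrow> real) \<Rightarrow> transformation \<Rightarrow> bool" where
  "ratio_preserving l h T \<longleftrightarrow>
     (\<forall>n F A. environment n (l n) (h n) F \<longrightarrow> algorithm_for n (l n) (h n) F A \<longrightarrow>
        approx_ratio n (l n) (h n) F (exp_welfare T A)
          \<ge> approx_ratio n (l n) (h n) F (\<lambda>v. welfare v (A v)))"

definition polynomial_time ::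
    "(nat \<Rightarrow> real) \<Rightarrow> (nat \<Rightarrow> real) \<Rightarrow> transformation \<Rightarrow> bool" where
  "polynomial_time l h T \<longleftrightarrow>
     (\<exists>p :: nat poly. \<forall>n F A.
        environment n (l n) (h n) F \<longrightarrow> algorithm_for n (l n) (h n) F A \<longrightarrow>
        (\<forall>v\<in>valuations n (l n) (h n). \<forall>(Q, t, x)\<in>set_pmf (run (T v) A). t \<le> poly p n))"

definition queries_within ::
    "(nat \<Rightarrow> real) \<Rightarrow> (nat \<Rightarrow> real) \<Rightarrow> (nat \<Rightarrow> real) \<Rightarrow> transformation \<Rightarrow> bool" where
  "queries_within f l h T \<longleftrightarrow>
     (\<forall>n F A. environment n (l n) (h n) F \<longrightarrow> algorithm_for n (l n) (h n) F A \<longrightarrow>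
        (\<forall>v\<in>valuations n (l n) (h n). \<forall>(Q, t, x)\<in>set_pmf (run (T v) A).
           \<forall>w\<in>Q. w \<in> valuations n (l n) (h n) \<and> real (hamming v w) < f n))"

end

theory Submission
  imports Defs
begin

text \<open>
  Since the transformation cannot see the feasibility set, one may add to it an allocation that
  has an enormous welfare at one nonconstant input \<open>v\<close> and a nonpositive one at all others. This makes
  \<open>v\<close> the worst input of the algorithm, so the transformation must already achieve at every
  nonconstant \<open>v\<close> at least the welfare of the algorithm at \<open>v\<close>.

  Let the algorithm return \<open>X0 = (0, 1, \<dots>, 1)\<close> if the agents \<open>1, \<dots>, n - 1\<close> are all low, and
  \<open>X1 = (B, 0, \<dots>, 0)\<close> with \<open>h B = l (n - 2)\<close> otherwise. At \<open>(h, l, \<dots>, l)\<close> the welfare of \<open>X0\<close>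
  is slightly larger than that of \<open>X1\<close>, so the transformation uses \<open>X0\<close> (or less) with positive
  probability. If it does so at an input with few high agents, it cannot reach the welfare of \<open>X1\<close>
  without giving a positive expected amount to some low agent; by monotonicity this agent still
  gets a positive amount when it becomes high, and only \<open>X0\<close> allows this. Raising agents one by one
  we arrive at an input with at least \<open>f n\<close> high agents where \<open>X0\<close> is still used, although all
  permitted queries return \<open>X1\<close>.
\<close>

section \<open>Computations\<close>

text \<open>A computation sees its oracle only through the answers to the queries it reaches. This
  is what later makes two algorithms indistinguishable to the transformation.\<close>

lemma run_cong:
  assumes "\<And>Q t x w. (Q, t, x) \<in> set_pmf (run c A) \<Longrightarrow> w \<in> Q \<Longrightarrow> A' w = A w"
  shows "run c A' = run c A"
  using assms
proof (induction c)
  case (Output x)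
  then show ?case by simp
next
  case (Compute c)
  have "A' w = A w" if "(Q, t, x) \<in> set_pmf (run c A)" "w \<in> Q" for Q t x w
    using that by (intro Compute.prems[of Q "Suc t" x w]) (auto intro: rev_image_eqI)
  then have "run c A' = run c A" by (rule Compute.IH)
  then show ?case by simp
next
  case (Toss p k)
  have "run (k b) A' = run (k b) A" if b: "b \<in> set_pmf (bernoulli_pmf p)" for b
  proof -
    have "A' w = A w" if "(Q, t, x) \<in> set_pmf (run (k b) A)" "w \<in> Q" for Q t x w
      using that b
      by (intro Toss.prems[of Q "Suc t" x w])
         (auto simp del: set_pmf_bernoulli intro!: bexI[of _ b] intro: rev_image_eqI)
    then show ?thesis by (rule Toss.IH[OF rangeI])
  qed
  then show ?case by (auto intro!: bind_pmf_cong)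
next
  case (Query w k)
  \<comment> \<open>The support is nonempty, so \<open>w\<close> lies in the query set of some
    reachable outcome and the premise applies to it.\<close>
  obtain Q t x where "(Q, t, x) \<in> set_pmf (run (k (A w)) A)"
    using set_pmf_not_empty by (metis ex_in_conv surj_pair)
  then have "(insert w Q, Suc t, x) \<in> set_pmf (run (Query w k) A)"
    by (auto intro: rev_image_eqI)
  then have "A' w = A w"
    using Query.prems by blast
  moreover have "A' u = A u" if "(Q, t, x) \<in> set_pmf (run (k (A w)) A)" "u \<in> Q" for Q t x u
    using that by (intro Query.prems[of "insert w Q" "Suc t" x u]) (auto intro: rev_image_eqI)
  then have "run (k (A w)) A' = run (k (A w)) A" by (rule Query.IH[OF rangeI])
  ultimately show ?case by simp
qed

text \<open>Once the oracle is fixed, only tosses branch, and only two ways. Expectations are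
  therefore finite sums, always integrable.\<close>

lemma finite_set_pmf_run: "finite (set_pmf (run c A))"
  by (induction c) auto

lemma finite_set_pmf_result: "finite (set_pmf (result T A v))"
  by (simp add: result_def finite_set_pmf_run)

lemma expectation_less:
  fixes g :: "'a \<Rightarrow> real"
  assumes fin: "finite (set_pmf p)" and le: "\<And>x. x \<in> set_pmf p \<Longrightarrow> g x \<le> c"
    and "y \<in> set_pmf p" "g y < c"
  shows "measure_pmf.expectation p g < c"
proof -
  have "measure_pmf.expectation p g = (\<Sum>x\<in>set_pmf p. pmf p x * g x)"
    using fin by (subst integral_measure_pmf[OF fin]) auto
  also have "\<dots> < (\<Sum>x\<in>set_pmf p. pmf p x * c)"
    using assms by (intro sum_strict_mono_ex1)
      (auto intro!: mult_left_mono bexI[of _ y] simp: pmf_positive)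
  also have "\<dots> = c"
    using sum_pmf_eq_1[OF fin] by (simp flip: sum_distrib_right)
  finally show ?thesis .
qed

lemma expectation_le:
  fixes g :: "'a \<Rightarrow> real"
  assumes "finite (set_pmf p)" "\<And>x. x \<in> set_pmf p \<Longrightarrow> g x \<le> c"
  shows "measure_pmf.expectation p g \<le> c"
  using assms
  by (intro measure_pmf.integral_le_const)
     (auto intro: integrable_measure_pmf_finite simp: AE_measure_pmf_iff)

section \<open>Finitely generated environments\<close>

text \<open>The downward closure of \<open>X\<close>; entries may become arbitrarily negative, as
  \<open>downward_closed\<close> demands.\<close>

definition down :: "allocation set \<Rightarrow> allocation set" where
  "down X = {x. \<exists>t\<in>X. list_all2 (\<le>) x t}"

lemma subset_down: "X \<subseteq> down X"
  by (auto simp: down_def list_all2_conv_all_nth)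

lemma down_mono: "X \<subseteq> Y \<Longrightarrow> down X \<subseteq> down Y"
  by (auto simp: down_def)

lemma downward_closed_down: "downward_closed (down X)"
  unfolding downward_closed_def down_def list_all2_conv_all_nth
  by (force simp: nth_list_update)

lemma finite_valuations: "finite (valuations n l h)"
proof -
  have "valuations n l h = {v. set v \<subseteq> {l, h} \<and> length v = n}"
    by (auto simp: valuations_def)
  then show ?thesis
    using finite_lists_length_eq[of "{l, h}" n] by simp
qed

lemma valuations_nth: "v \<in> valuations n l h \<Longrightarrow> i < n \<Longrightarrow> v ! i = l \<or> v ! i = h"
  unfolding valuations_def using nth_mem by fastforce

lemma valuations_update:
  "v \<in> valuations n l h \<Longrightarrow> a \<in> {l, h} \<Longrightarrow> v[i := a] \<in> valuations n l h"
  unfolding valuations_def using set_update_subset_insert[of v i a] by auto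

lemma welfare_mono:
  assumes "v \<in> valuations n l h" "0 < l" "l < h" "length t = n" "list_all2 (\<le>) x t"
  shows "welfare v x \<le> welfare v t"
  unfolding welfare_def
proof (rule sum_mono)
  fix i assume "i \<in> {..<length v}"
  then have "i < n" using assms(1) by (simp add: valuations_def)
  then have "0 \<le> v ! i" "x ! i \<le> t ! i"
    using valuations_nth[OF assms(1), of i] assms(2-) by (auto simp: list_all2_conv_all_nth)
  then show "v ! i * x ! i \<le> v ! i * t ! i"
    by (simp add: mult_left_mono)
qed

context
  fixes n :: nat and l h :: real and X :: "allocation set"
  assumes lh: "0 < l" "l < h"
    and X: "finite X" "\<And>t. t \<in> X \<Longrightarrow> length t = n"
    and pos: "\<And>v. v \<in> valuations n l h \<Longrightarrow> \<exists>t\<in>X. 0 < welfare v t"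
begin

text \<open>Valuations are positive, so no element of the closure is worth more than the generator
  above it, and there are finitely many generators.\<close>

lemma max_generator:
  assumes "v \<in> valuations n l h"
  obtains t where "t \<in> X" "\<And>y. y \<in> down X \<Longrightarrow> welfare v y \<le> welfare v t" "0 < welfare v t"
proof -
  obtain u where u: "u \<in> X" "0 < welfare v u"
    using pos assms by blast
  have "Max (welfare v ` X) \<in> welfare v ` X"
    using u X(1) by (intro Max_in) auto
  then obtain t where "t \<in> X" "Max (welfare v ` X) = welfare v t"
    by auto
  then have t: "t \<in> X" "\<And>s. s \<in> X \<Longrightarrow> welfare v s \<le> welfare v t"
    using X(1) by (auto simp flip: \<open>Max (welfare v ` X) = welfare v t\<close>)
  have "welfare v y \<le> welfare v t" if "y \<in> down X" for y
    using that t welfare_mono[OF assms lh X(2)] by (fastforce simp: down_def)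
  then show thesis
    using that t u by (meson less_le_trans)
qed

lemma environment_down: "environment n l h (down X)"
  unfolding environment_def
proof (intro conjI ballI)
  fix x assume "x \<in> down X" then show "length x = n"
    using X(2) by (auto simp: down_def dest: list_all2_lengthD)
next
  fix v assume "v \<in> valuations n l h"
  then show "\<exists>x\<in>down X. (\<forall>y\<in>down X. welfare v y \<le> welfare v x) \<and> 0 < welfare v x"
    using max_generator subset_down by (metis subsetD)
qed (rule downward_closed_down)

lemma OPT_down:
  assumes "v \<in> valuations n l h"
  obtains t where "t \<in> X" "OPT (down X) v = welfare v t"
    "\<And>y. y \<in> down X \<Longrightarrow> welfare v y \<le> welfare v t" "0 < welfare v t"
proof -
  obtain t where t: "t \<in> X" "\<And>y. y \<in> down X \<Longrightarrow> welfare v y \<le> welfare v t" "0 < welfare v t"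
    using max_generator[OF assms] by blast
  have "OPT (down X) v = welfare v t"
    unfolding OPT_def using t subset_down
    by (intro cSup_eq_maximum) auto
  then show thesis using that t by blast
qed

end

section \<open>The welfare of the transformed algorithm\<close>

text \<open>High agents of \<open>v\<close> receive \<open>a\<close> and low agents
  \<open>- b\<close>, with \<open>a\<close> and \<open>b\<close> both at least
  \<open>K / (h - l)\<close>. Changing any coordinate of \<open>v\<close> then costs at least
  \<open>K\<close>, the whole welfare at \<open>v\<close>.\<close>

lemma peaked_allocation:
  assumes v: "v \<in> valuations n l h" and lh: "0 < l" "l < h" and "0 < K"
    and low: "\<exists>i<n. v ! i = l" and high: "\<exists>i<n. v ! i = h"
  obtains z where "length z = n" "welfare v z = K"
    "\<And>w. w \<in> valuations n l h \<Longrightarrow> w \<noteq> v \<Longrightarrow> welfare w z \<le> 0"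
proof -
  define p where "p = real (card ({..<n} \<inter> {i. v ! i = h}))"
  define q where "q = real (card ({..<n} \<inter> - {i. v ! i = h}))"
  \<comment> \<open>\<open>a\<close> solves \<open>p * h * a - q * l * b = K\<close>. Since
    \<open>q\<close> is at least 1, \<open>a\<close> grows with \<open>b\<close>, and this
    \<open>b\<close> is large enough to push \<open>a\<close> above \<open>K / (h - l)\<close>
    too.\<close>
  define b where "b = K / (h - l) * (1 + h * p / l)"
  define a where "a = (K + b * q * l) / (h * p)"
  define z where "z = map (\<lambda>i. if v ! i = h then a else - b) [0..<n]"
  have p: "0 < p" using high by (auto simp: p_def card_gt_0_iff)
  have "{..<n} \<inter> - {i. v ! i = h} \<noteq> {}" using low lh by auto
  then have "0 < card ({..<n} \<inter> - {i. v ! i = h})" by (simp add: card_gt_0_iff)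
  then have q: "1 \<le> q" unfolding q_def by linarith
  have K: "0 < K / (h - l)" using lh \<open>0 < K\<close> by simp
  have b: "K / (h - l) \<le> b"
    using mult_left_mono[of 1 "1 + h * p / l" "K / (h - l)"] K lh p by (simp add: b_def)
  have "K / (h - l) * (h * p) \<le> b * l"
    using K lh p by (simp add: b_def field_simps)
  also have "\<dots> \<le> b * q * l"
    using q b K lh by (simp add: mult_le_cancel_left1)
  finally have "K / (h - l) * (h * p) \<le> K + b * q * l"
    using \<open>0 < K\<close> by simp
  then have a: "K / (h - l) \<le> a"
    using p lh by (simp add: a_def pos_le_divide_eq)
  have len: "length w = n" if "w \<in> valuations n l h" for w
    using that by (simp add: valuations_def)
  have "welfare v z = (\<Sum>i<n. if v ! i = h then h * a else - (l * b))"
    unfolding welfare_def len[OF v] using valuations_nth[OF v]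
    by (intro sum.cong) (auto simp: z_def)
  also have "\<dots> = p * (h * a) - q * (l * b)"
    by (simp add: sum.If_cases p_def q_def)
  also have "\<dots> = K"
    using p lh by (simp add: a_def)
  finally have vz: "welfare v z = K" .
  have "welfare w z \<le> 0" if w: "w \<in> valuations n l h" "w \<noteq> v" for w
  proof -
    have d: "(w ! i - v ! i) * z ! i \<le> (if w ! i = v ! i then 0 else - K)" if "i < n" for i
    proof -
      have "(h - l) * (K / (h - l)) \<le> (h - l) * a" "(h - l) * (K / (h - l)) \<le> (h - l) * b"
        using a b lh by (intro mult_left_mono; simp)+
      then have "K \<le> (h - l) * a" "K \<le> (h - l) * b"
        using lh by auto
      then show ?thesis
        using valuations_nth[OF w(1) that] valuations_nth[OF v that] that lh
        by (auto simp: z_def algebra_simps)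
    qed
    obtain j where j: "j < n" "w ! j \<noteq> v ! j"
      using w len v by (metis nth_equalityI)
    have "welfare w z - welfare v z = (\<Sum>i<n. (w ! i - v ! i) * z ! i)"
      using len v w by (simp add: welfare_def algebra_simps sum_subtractf)
    also have "\<dots> \<le> (\<Sum>i<n. if w ! i = v ! i then 0 else - K)"
      by (intro sum_mono d) simp
    \<comment> \<open>All terms are nonpositive, so a single changed coordinate \<open>j\<close>
      suffices.\<close>
    also have "\<dots> \<le> (\<Sum>i<n. if i = j then - K else 0)"
      using \<open>0 < K\<close> j by (intro sum_mono) auto
    also have "\<dots> = - K" using j by simp
    finally show ?thesis using vz by simp
  qed
  then show thesis
    using that[of z] vz by (simp add: z_def)
qed

text \<open>Adding a peak of height \<open>K\<close> at \<open>v\<close> makes the ratio of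
  \<open>A\<close> equal to \<open>welfare v (A v) / K\<close>. The ratio of the transformed
  algorithm is at most \<open>exp_welfare T A v / K\<close>, and \<open>K\<close> cancels.\<close>

lemma exp_welfare_ge:
  fixes l h :: "nat \<Rightarrow> real"
  assumes T: "ratio_preserving l h T" and lh: "0 < l n" "l n < h n"
    and X: "finite X" "\<And>t. t \<in> X \<Longrightarrow> length t = n"
    and A: "algorithm_for n (l n) (h n) (down X) A"
    and pos: "\<And>w. w \<in> valuations n (l n) (h n) \<Longrightarrow> 0 < welfare w (A w)"
    and v: "v \<in> valuations n (l n) (h n)" "\<exists>i<n. v ! i = l n" "\<exists>i<n. v ! i = h n"
  shows "welfare v (A v) \<le> exp_welfare T A v"
proof -
  let ?V = "valuations n (l n) (h n)"
  have A_down: "A w \<in> down X" if "w \<in> ?V" for w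
    using A that by (simp add: algorithm_for_def)
  have X_pos: "\<exists>t\<in>X. 0 < welfare w t" if w: "w \<in> ?V" for w
  proof -
    obtain t where "t \<in> X" "list_all2 (\<le>) (A w) t"
      using A_down[OF w] by (auto simp: down_def)
    then show ?thesis
      using welfare_mono[OF w lh X(2)] pos[OF w] less_le_trans by blast
  qed
  have OPT_X: "welfare w y \<le> OPT (down X) w" if "w \<in> ?V" "y \<in> down X" for w y
    by (rule OPT_down[OF lh X X_pos that(1)]) (use that(2) in auto)
  \<comment> \<open>\<open>K\<close> must be so large that, against the optima of
    \<open>down X\<close>, no input has a ratio below \<open>welfare v (A v) / K\<close>, and that
    the peak is optimal at \<open>v\<close>.\<close>
  have "eventually (\<lambda>K. \<forall>w\<in>?V. welfare v (A v) * OPT (down X) w / welfare w (A w) \<le> K) at_top"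
    using finite_valuations by (auto simp: eventually_ball_finite_distrib eventually_ge_at_top)
  moreover have "eventually (\<lambda>K. max 1 (OPT (down X) v) \<le> K) at_top"
    by (rule eventually_ge_at_top)
  ultimately have "eventually (\<lambda>K. (\<forall>w\<in>?V. welfare v (A v) * OPT (down X) w / welfare w (A w) \<le> K)
      \<and> max 1 (OPT (down X) v) \<le> K) at_top"
    by (rule eventually_conj)
  then obtain K where "(\<forall>w\<in>?V. welfare v (A v) * OPT (down X) w / welfare w (A w) \<le> K)
      \<and> max 1 (OPT (down X) v) \<le> K"
    using eventually_happens'[OF trivial_limit_at_top_linorder] by blast
  then have K: "\<And>w. w \<in> ?V \<Longrightarrow> welfare v (A v) * OPT (down X) w / welfare w (A w) \<le> K"
      "0 < K" "OPT (down X) v \<le> K"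
    by auto
  obtain z where z: "length z = n" "welfare v z = K"
      "\<And>w. w \<in> ?V \<Longrightarrow> w \<noteq> v \<Longrightarrow> welfare w z \<le> 0"
    using peaked_allocation[OF v(1) lh K(2) v(2,3)] by blast
  define Z where "Z = insert z X"
  have Z: "finite Z" "\<And>t. t \<in> Z \<Longrightarrow> length t = n" "\<And>w. w \<in> ?V \<Longrightarrow> \<exists>t\<in>Z. 0 < welfare w t"
    using X X_pos z by (auto simp: Z_def)
  have A_Z: "algorithm_for n (l n) (h n) (down Z) A"
    using A down_mono[of X Z] by (auto simp: algorithm_for_def Z_def)
  have OPT_v: "OPT (down Z) v = K"
  proof -
    obtain t where t: "t \<in> Z" "OPT (down Z) v = welfare v t"
        "\<And>y. y \<in> down Z \<Longrightarrow> welfare v y \<le> welfare v t"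
      by (rule OPT_down[OF lh Z v(1)]) auto
    have "K \<le> welfare v t"
      using t(3)[of z] z subset_down[of Z] by (auto simp: Z_def)
    moreover have "welfare v t \<le> K"
    proof (cases "t = z")
      case False
      then have "t \<in> down X" using t subset_down[of X] by (auto simp: Z_def)
      then show ?thesis
        using OPT_X[OF v(1)] K(3) by (metis order_trans)
    qed (use z in simp)
    ultimately show ?thesis using t(2) by simp
  qed
  have ratio: "welfare v (A v) / K \<le> welfare w (A w) / OPT (down Z) w" if w: "w \<in> ?V" for w
  proof (cases "w = v")
    case False
    obtain t where t: "t \<in> Z" "OPT (down Z) w = welfare w t" "0 < welfare w t"
      by (rule OPT_down[OF lh Z w]) auto
    \<comment> \<open>The peak is worth at most 0 at \<open>w\<close>, so the optimum there still
      comes from \<open>X\<close> and has not grown.\<close>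
    then have "t \<in> down X"
      using z(3)[OF w False] subset_down[of X] by (auto simp: Z_def)
    then have le: "OPT (down Z) w \<le> OPT (down X) w"
      using OPT_X[OF w] t(2) by metis
    have "welfare v (A v) * OPT (down Z) w \<le> welfare v (A v) * OPT (down X) w"
      using le pos[OF v(1)] by simp
    also have "\<dots> \<le> K * welfare w (A w)"
      using K(1)[OF w] pos[OF w] by (simp add: pos_divide_le_eq)
    finally show ?thesis
      using K(2) t by (simp add: field_simps)
  qed (use OPT_v in simp)
  have "welfare v (A v) / K \<le> approx_ratio n (l n) (h n) (down Z) (\<lambda>v. welfare v (A v))"
    unfolding approx_ratio_def using ratio v(1) finite_valuations
    by (subst Min_ge_iff) auto
  \<comment> \<open>\<open>exp_welfare T A\<close> does not mention the feasible set, so it is the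
    same function in the enlarged environment.\<close>
  also have "\<dots> \<le> approx_ratio n (l n) (h n) (down Z) (exp_welfare T A)"
    using T environment_down[OF lh Z] A_Z by (simp add: ratio_preserving_def)
  also have "\<dots> \<le> exp_welfare T A v / K"
    unfolding approx_ratio_def using v(1) finite_valuations OPT_v
    by (intro Min_le) (auto intro!: image_eqI[of _ _ v])
  finally show ?thesis
    using K(2) by (simp add: divide_le_cancel)
qed

section \<open>The impossibility\<close>

text \<open>\<open>K\<close> is the number of agents to be raised: at least the query radius, yet
  below \<open>l n * (n - 2) / h n\<close>, the amount called \<open>B\<close> in the proof.\<close>

lemma query_radius_large:
  fixes l h f :: "nat \<Rightarrow> real"
  assumes valid: "valid_transformation l h T" and mono: "monotone_transformation l h T"
    and ratio: "ratio_preserving l h T" and queries: "queries_within f l h T"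
    and lh: "0 < l n" "l n < h n" and n: "2 < n"
    and K: "f n \<le> real K" "real K * h n < l n * (real n - 2)"
  shows False
proof -
  define B where "B = l n * (real n - 2) / h n"
  define X0 where "X0 = map (\<lambda>i. if i = 0 then 0 else 1 :: real) [0..<n]"
  define X1 where "X1 = map (\<lambda>i. if i = 0 then B else 0) [0..<n]"
  define A where "A w = (if \<exists>i\<in>{1..<n}. w ! i = h n then X1 else X0)" for w :: valuation
  let ?V = "valuations n (l n) (h n)"
  let ?F = "down {X0, X1}"
  let ?S = "\<lambda>v. set_pmf (result T A v)"
  define H where "H v = {i\<in>{1..<n}. v ! i = h n}" for v :: valuation
  define L where "L v = {i\<in>{1..<n}. v ! i = l n}" for v :: valuation
  have len: "length X0 = n" "length X1 = n"
    by (auto simp: X0_def X1_def)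
  have hB: "h n * B = l n * (real n - 2)"
    using lh by (simp add: B_def)
  have B: "0 < B" using n lh by (simp add: B_def)
  have K_B: "real K < B"
    using K(2) lh by (simp add: B_def pos_less_divide_eq)
  have B_n: "B \<le> real n - 2"
    using lh n by (simp add: B_def pos_divide_le_eq mult.commute mult_right_mono)
  have split: "{..<n} = insert 0 (L v \<union> H v)" if "v \<in> ?V" for v
    using valuations_nth[OF that] n by (auto simp: L_def H_def Suc_le_eq)
  have LH: "finite (L v)" "finite (H v)" "0 \<notin> L v \<union> H v" "L v \<inter> H v = {}" for v
    using lh by (auto simp: L_def H_def)
  have lt_n: "\<And>i v. i \<in> L v \<Longrightarrow> i < n" "\<And>i v. i \<in> H v \<Longrightarrow> i < n"
    by (auto simp: L_def H_def)
  have welfare_split: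
    "welfare v x = v ! 0 * x ! 0 + (\<Sum>i\<in>L v. l n * x ! i) + (\<Sum>i\<in>H v. h n * x ! i)"
    if v: "v \<in> ?V" for v x
  proof -
    have "welfare v x = (\<Sum>i\<in>insert 0 (L v \<union> H v). v ! i * x ! i)"
      using v split[OF v] by (simp add: welfare_def valuations_def)
    also have "\<dots> = v ! 0 * x ! 0 + ((\<Sum>i\<in>L v. v ! i * x ! i) + (\<Sum>i\<in>H v. v ! i * x ! i))"
      using LH[of v] by (simp add: sum.union_disjoint)
    finally show ?thesis
      by (simp add: L_def H_def)
  qed
  have card_LH: "real (card (L v)) + real (card (H v)) = real n - 1" if v: "v \<in> ?V" for v
  proof -
    have "n = Suc (card (L v \<union> H v))"
      using arg_cong[OF split[OF v], of card] LH[of v] by simp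
    then show ?thesis using LH[of v] by (simp add: card_Un_disjoint)
  qed
  have nth_X0: "X0 ! 0 = 0" "\<And>v i. i \<in> L v \<Longrightarrow> X0 ! i = 1" "\<And>v i. i \<in> H v \<Longrightarrow> X0 ! i = 1"
    and nth_X1: "X1 ! 0 = B" "\<And>v i. i \<in> L v \<Longrightarrow> X1 ! i = 0" "\<And>v i. i \<in> H v \<Longrightarrow> X1 ! i = 0"
    using n by (auto simp: X0_def X1_def L_def H_def)
  have welfare_X0: "welfare v X0 = l n * card (L v) + h n * card (H v)"
    and welfare_X1: "welfare v X1 = v ! 0 * B" if v: "v \<in> ?V" for v
    using nth_X0 nth_X1 by (simp_all add: welfare_split[OF v])
  have pos: "0 < welfare v X0" "0 < welfare v X1" if v: "v \<in> ?V" for v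
  proof -
    have "0 < l n * (real (card (L v)) + real (card (H v)))"
      using lh n card_LH[OF v] by simp
    also have "\<dots> \<le> welfare v X0"
      using lh by (simp add: welfare_X0[OF v] distrib_left mult_right_mono)
    finally show "0 < welfare v X0" .
    show "0 < welfare v X1"
      using valuations_nth[OF v, of 0] n B lh by (auto simp: welfare_X1[OF v])
  qed
  \<comment> \<open>The environment generated by \<open>X1\<close> alone serves the final step,
    where \<open>A\<close> is replaced by the constant \<open>X1\<close>.\<close>
  have env: "environment n (l n) (h n) ?F" "environment n (l n) (h n) (down {X1})"
    using lh len pos by (auto intro!: environment_down)
  have alg: "algorithm_for n (l n) (h n) ?F A" "algorithm_for n (l n) (h n) (down {X1}) (\<lambda>_. X1)"
    using subset_down[of "{X0, X1}"] subset_down[of "{X1}"]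
    by (auto simp: algorithm_for_def A_def)
  have supp: "list_all2 (\<le>) x X0 \<or> list_all2 (\<le>) x X1" if "v \<in> ?V" "x \<in> ?S v" for v x
  proof -
    have "x \<in> ?F" using valid env alg that unfolding valid_transformation_def by blast
    then show ?thesis by (auto simp: down_def)
  qed
  have exp_ge: "welfare v (A v) \<le> exp_welfare T A v"
    if v: "v \<in> ?V" "v ! 0 = h n" "L v \<noteq> {}" for v
  proof (rule exp_welfare_ge[where X = "{X0, X1}", OF ratio lh _ _ alg(1) _ v(1)])
    show "\<exists>i<n. v ! i = l n"
      using v(3) by (auto simp: L_def)
    show "\<exists>i<n. v ! i = h n"
      using v(2) n by (intro exI[of _ 0]) simp
  qed (use len pos in \<open>auto simp: A_def\<close>)
  have L_ne: "L v \<noteq> {}" if "v \<in> ?V" "card (H v) \<le> K" for v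
    using card_LH[OF that(1)] that(2) K_B B_n by auto
  have exp_ge_B: "h n * B \<le> exp_welfare T A v"
    if v: "v \<in> ?V" "v ! 0 = h n" "card (H v) \<le> K" for v
  proof -
    have "h n * B \<le> welfare v (A v)"
    proof (cases "H v = {}")
      case True
      then have "A v = X0" by (auto simp: A_def H_def)
      moreover have "welfare v X0 = l n * (real n - 1)"
        using True card_LH[OF v(1)] by (simp add: welfare_X0[OF v(1)])
      ultimately show ?thesis using lh by (simp add: hB)
    next
      case False
      then have "A v = X1" by (auto simp: A_def H_def)
      then show ?thesis using v by (simp add: welfare_X1)
    qed
    then show ?thesis using exp_ge[OF v(1,2) L_ne[OF v(1,3)]] by simp
  qed
  \<comment> \<open>Induction on the number of raised agents other than agent 0; the invariant is
    that an output below \<open>X0\<close> has positive probability.\<close>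
  have "\<exists>v\<in>?V. v ! 0 = h n \<and> card (H v) = k \<and> (\<exists>x\<in>?S v. list_all2 (\<le>) x X0)"
    if "k \<le> K" for k
    using that
  proof (induction k)
    case 0
    define v where "v = (replicate n (l n))[0 := h n]"
    have v: "v \<in> ?V"
      unfolding v_def by (intro valuations_update) (auto simp: valuations_def)
    have v0: "v ! 0 = h n" and Hv: "H v = {}"
      using n lh by (auto simp: v_def H_def nth_list_update)
    have "\<exists>x\<in>?S v. list_all2 (\<le>) x X0"
    proof (rule ccontr)
      assume "\<not> ?thesis"
      then have "list_all2 (\<le>) x X1" if "x \<in> ?S v" for x
        using supp[OF v that] that by blast
      then have "exp_welfare T A v \<le> welfare v X1"
        unfolding exp_welfare_def
        by (intro expectation_le finite_set_pmf_result welfare_mono[OF v lh len(2)]) auto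
      moreover have "A v = X0"
        using Hv by (auto simp: A_def H_def)
      moreover have "welfare v X0 = l n * (real n - 1)"
        using Hv card_LH[OF v] by (simp add: welfare_X0[OF v])
      then have "welfare v X1 < welfare v X0"
        using lh by (simp add: welfare_X1[OF v] v0 hB)
      moreover have "L v \<noteq> {}" using L_ne v Hv by simp
      ultimately show False
        using exp_ge[OF v v0] by simp
    qed
    then show ?case using v v0 Hv by (intro bexI[of _ v]) auto
  next
    case (Suc k)
    then obtain v y where v: "v \<in> ?V" "v ! 0 = h n" "card (H v) = k"
        and y: "y \<in> ?S v" "list_all2 (\<le>) y X0"
      by auto
    \<comment> \<open>The welfare without the share of the low agents. It is at most
      \<open>h n * k\<close> below \<open>X0\<close> and at most \<open>h n * B\<close> below
      \<open>X1\<close>. As \<open>k < B\<close>, the output \<open>y\<close> makes its mean smaller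
      than \<open>h n * B\<close>, and low agents must supply the rest.\<close>
    define g where "g x = welfare v x - (\<Sum>i\<in>L v. l n * x ! i)" for x
    have g: "g x = h n * x ! 0 + (\<Sum>i\<in>H v. h n * x ! i)" for x
      using welfare_split[OF v(1)] v(2) by (simp add: g_def)
    have g_X0: "g x < h n * B" if "list_all2 (\<le>) x X0" for x
    proof -
      have "x ! i \<le> X0 ! i" if "i < n" for i
        using \<open>list_all2 (\<le>) x X0\<close> that len by (simp add: list_all2_conv_all_nth)
      then have "h n * x ! 0 + (\<Sum>i\<in>H v. h n * x ! i) \<le> h n * X0 ! 0 + (\<Sum>i\<in>H v. h n * X0 ! i)"
        using lh lt_n n by (intro add_mono sum_mono mult_left_mono) auto
      also have "\<dots> = h n * k"
        using nth_X0 v(3) by simp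
      also have "\<dots> < h n * B"
        using Suc.prems K_B lh by simp
      finally show ?thesis unfolding g .
    qed
    have g_X1: "g x \<le> h n * B" if "list_all2 (\<le>) x X1" for x
    proof -
      have "x ! i \<le> X1 ! i" if "i < n" for i
        using \<open>list_all2 (\<le>) x X1\<close> that len by (simp add: list_all2_conv_all_nth)
      then have "h n * x ! 0 + (\<Sum>i\<in>H v. h n * x ! i) \<le> h n * X1 ! 0 + (\<Sum>i\<in>H v. h n * X1 ! i)"
        using lh lt_n n by (intro add_mono sum_mono mult_left_mono) auto
      then show ?thesis unfolding g using nth_X1 by simp
    qed
    have "measure_pmf.expectation (result T A v) g < h n * B"
      using supp[OF v(1)] g_X0 g_X1 y
      by (intro expectation_less[OF finite_set_pmf_result, where y = y]) (auto intro: less_imp_le)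
    moreover have "measure_pmf.expectation (result T A v) g
        = exp_welfare T A v - (\<Sum>i\<in>L v. l n * exp_alloc T A v i)"
      unfolding g_def exp_welfare_def exp_alloc_def
      by (simp add: integrable_measure_pmf_finite finite_set_pmf_result)
    moreover have "h n * B \<le> exp_welfare T A v"
      using exp_ge_B v Suc.prems by simp
    ultimately have "0 < (\<Sum>i\<in>L v. l n * exp_alloc T A v i)"
      by linarith
    then obtain i where i: "i \<in> L v" "0 < l n * exp_alloc T A v i"
      by (meson not_le sum_nonpos)
    define w where "w = v[i := h n]"
    have iv: "v ! i = l n" "i < n" "0 < i" "length v = n"
      using i v(1) by (auto simp: L_def valuations_def)
    have w: "w \<in> ?V" unfolding w_def using v(1) by (intro valuations_update) auto
    \<comment> \<open>Monotonicity keeps the expected amount of \<open>i\<close> positive after the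
      raise; \<open>X1\<close> gives nothing to \<open>i\<close>, so some output lies below
      \<open>X0\<close>.\<close>
    have "exp_alloc T A v i \<le> exp_alloc T A w i"
      using mono env(1) alg(1) v(1) iv lh unfolding monotone_transformation_def w_def
      by (metis insertCI less_imp_le)
    then have "0 < exp_alloc T A w i"
      using i(2) lh by (auto simp: zero_less_mult_iff)
    then obtain x where x: "x \<in> ?S w" "0 < x ! i"
      unfolding exp_alloc_def
      using expectation_le[OF finite_set_pmf_result, of T A w "\<lambda>x. x ! i" 0] by fastforce
    then have "\<not> list_all2 (\<le>) x X1"
      using iv len by (auto simp: list_all2_conv_all_nth X1_def)
    then have "list_all2 (\<le>) x X0"
      using supp[OF w x(1)] by blast
    moreover have "H w = insert i (H v)" "i \<notin> H v"
      using iv lh by (auto simp: w_def H_def nth_list_update)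
    then have "card (H w) = Suc k"
      using v(3) LH by simp
    moreover have "w ! 0 = h n"
      using iv v(2) by (simp add: w_def)
    ultimately show ?case using w x(1) by blast
  qed
  then obtain v y where v: "v \<in> ?V" "v ! 0 = h n" "card (H v) = K"
      and y: "y \<in> ?S v" "list_all2 (\<le>) y X0"
    by blast
  \<comment> \<open>A query differs from \<open>v\<close> in fewer than \<open>K\<close> places, so
    one of the \<open>K\<close> high agents counted by \<open>H v\<close> is still high there and
    \<open>A\<close> answers \<open>X1\<close>.\<close>
  have "run (T v) (\<lambda>_. X1) = run (T v) A"
  proof (rule run_cong)
    fix Q t x w assume "(Q, t, x) \<in> set_pmf (run (T v) A)" "w \<in> Q"
    then have "real (hamming v w) < f n"
      using queries env(1) alg(1) v(1) unfolding queries_within_def by fastforce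
    then have less: "hamming v w < K" using K(1) by simp
    show "X1 = A w"
    proof (rule ccontr)
      assume "X1 \<noteq> A w"
      then have "H v \<subseteq> {i. i < length v \<and> v ! i \<noteq> w ! i}"
        using v(1) by (auto simp: A_def H_def valuations_def split: if_splits)
      then have "card (H v) \<le> hamming v w"
        unfolding hamming_def by (intro card_mono) auto
      then show False using less v(3) by simp
    qed
  qed
  then have "?S v \<subseteq> down {X1}"
    using valid env(2) alg(2) v(1) unfolding valid_transformation_def result_def by metis
  then have supp_X1: "list_all2 (\<le>) x X1" if "x \<in> ?S v" for x
    using that by (auto simp: down_def)
  \<comment> \<open>\<open>y\<close> lies below both \<open>X0\<close> and \<open>X1\<close>, whose
    supports are disjoint.\<close>
  have "y ! i \<le> 0" if "i < n" for i
    using supp_X1[OF y(1)] y(2) that len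
    by (cases "i = 0") (auto simp: list_all2_conv_all_nth X0_def X1_def)
  then have "welfare v y \<le> 0"
    using v(1) valuations_nth[OF v(1)] lh unfolding welfare_def
    by (intro sum_nonpos mult_nonneg_nonpos) (force simp: valuations_def)+
  also have "0 < h n * B" using B lh by simp
  finally have "welfare v y < h n * B" .
  moreover have "welfare v x \<le> h n * B" if "x \<in> ?S v" for x
    using welfare_mono[OF v(1) lh len(2) supp_X1[OF that]] v(2) by (simp add: welfare_X1[OF v(1)])
  ultimately have "exp_welfare T A v < h n * B"
    unfolding exp_welfare_def using y(1) by (intro expectation_less[OF finite_set_pmf_result])
  then show False
    using exp_ge_B[OF v(1,2)] v(3) by simp
qed

theorem theorem4:
  fixes l h f :: "nat \<Rightarrow> real"
  assumes "\<And>n. 0 < l n" and "\<And>n. l n < h n"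
    and "\<exists>c. \<forall>n. h n / l n = c"
    and "f \<in> o(\<lambda>n. real n)"
  shows "\<not> (\<exists>T :: transformation.
      valid_transformation l h T \<and> polynomial_time l h T \<and>
      monotone_transformation l h T \<and> ratio_preserving l h T \<and>
      queries_within f l h T)"
proof -
  obtain c where "\<And>n. h n / l n = c" using assms(3) by blast
  then have c: "h n = c * l n" for n
    using assms(1)[of n] by (metis less_irrefl nonzero_eq_divide_eq)
  have "0 < c * l 0" using assms(1,2)[of 0] by (simp flip: c)
  then have "0 < c" using assms(1)[of 0] by (simp add: zero_less_mult_iff)
  \<comment> \<open>The factor \<open>1 / (2 * c)\<close> gives \<open>c * K\<close> at most
    \<open>n / 2 + c\<close>, which is less than \<open>n - 2\<close> once
    \<open>n > 2 * c + 4\<close>.\<close>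
  then have "eventually (\<lambda>n. norm (f n) \<le> 1 / (2 * c) * norm (real n)) sequentially"
    by (intro landau_o.smallD[OF assms(4)]) simp
  moreover have "eventually (\<lambda>n. nat \<lceil>2 * c + 4\<rceil> < n) sequentially"
    by (rule eventually_gt_at_top)
  ultimately obtain n where n: "norm (f n) \<le> 1 / (2 * c) * norm (real n)" "nat \<lceil>2 * c + 4\<rceil> < n"
    using eventually_happens'[OF sequentially_bot eventually_conj] by blast
  \<comment> \<open>For negative \<open>f n\<close> this is 0, still an upper bound.\<close>
  define K where "K = nat \<lceil>f n\<rceil>"
  have n': "2 * c + 4 < real n" using n(2) by linarith
  have "real K \<le> norm (f n) + 1"
    unfolding K_def real_norm_def by linarith
  then have "c * real K \<le> c * (1 / (2 * c) * real n + 1)"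
    using n(1) \<open>0 < c\<close> by (intro mult_left_mono) auto
  also have "\<dots> = real n / 2 + c"
    using \<open>0 < c\<close> by (simp add: field_simps)
  also have "\<dots> < real n - 2"
    using n' by simp
  finally have "l n * (c * real K) < l n * (real n - 2)"
    using assms(1) by simp
  then have "real K * h n < l n * (real n - 2)"
    by (simp add: c mult_ac)
  moreover have "f n \<le> real K" unfolding K_def by linarith
  moreover have "2 < n" using n' \<open>0 < c\<close> by linarith
  ultimately show ?thesis
    using query_radius_large[of l h _ f n K] assms(1,2) by blast
qed

end
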